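(* Let $m>0$, $0<q<1$, let $u_0\ge 0$, $u_0\not\equiv0$, be continuous on $\mathbb{R}$ with compact support $[-s_0,s_0]$, and let $(u_h^n)$ be the numerical solution defined in the context, with $u_h^0\not\equiv0$. Suppose that at each step the time step satisfies $$\frac{\Delta t_n}{h}\|v_h^n\|_\infty\le\frac m2\qquad\text{and}\qquad mq\,\Delta t_n\|u_h^{n+1/2}\|_\infty^q<1 .$$ Then the numerical solution exists at least until the time $$T_1=\frac{1}{mq\,\|u_h^0\|_\infty^q},$$ and for all $n$ with $t_n<T_1$, $$\|u_h^n\|_\infty\le\frac{\|u_h^0\|_\infty}{\left(1-mq\,t_n\|u_h^0\|_\infty^q\right)^{1/q}} .$$
   Context: **Problem.** $m>0$, $0<q<1$; the Cauchy problem is $u_t-\frac1m u_x^2-u\,u_{xx}=m\,u^{q+1}$ on $\mathbb{R}\times(0,\infty)$, $u(\cdot,0)=u_0$, where $u_0\ge0$ is continuous with compact support $[-s_0,s_0]$. Norms $\|\cdot\|_s$ are those of $L^s(\mathbb{R})$. **Mesh and spaces.** Let $N\ge2$ be an integer, $h=s_0/N$, $x_i=ih$ ($i\in\mathbb{Z}$), $I_i=(x_{i-1},x_i)$. Let $\Delta t_n>0$ be the time steps, $t_0=0$, $t_{n+1}=t_n+\Delta t_n$. At level $n$ there is an interval $[-s_-^n,s_+^n]$, with $s_\pm^0=s_0$; put $N_\pm^n=\lfloor s_\pm^n/h\rfloor$ and $h_\pm^n=s_\pm^n-(N_\pm^n-1)h$, so $h\le h_\pm^n<2h$. $V_h^n$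 is the space of continuous functions on $\mathbb{R}$ that vanish outside $(-s_-^n,s_+^n)$ and are affine on each $I_i$, $-N_-^n+2\le i\le N_+^n-1$, and on the two end intervals $(-s_-^n,x_{-N_-^n+1})$ and $(x_{N_+^n-1},s_+^n)$. $\pi_h^n$ is Lagrange interpolation into $V_h^n$ at the nodes $x_i$, $-N_-^n+1\le i\le N_+^n-1$. Write $\phi_i=\phi_h(x_i)$. **Scheme.** $u_h^0=\pi_h^0u_0$. Given $u_h^n\in V_h^n$, let $v_h^n$ be its piecewise constant derivative: $v_i^n=(u_i^n-u_{i-1}^n)/h$ on $I_i$ for $-N_-^n+2\le i\le N_+^n-1$, $v^n_{N_+^n}=-u^n_{N_+^n-1}/h_+^n$ on the right end interval, $v^n_{-N_-^n+1}=u^n_{-N_-^n+1}/h_-^n$ on the left end interval. (1) Hyperbolic step, for $u_t=\frac1m u_x^2$, solved exactly by the Hopf–Lax formula: $u^{n+1/2}(x)=\sup_{y\in\mathbb{R}}\{u_h^n(y)-\frac{m(x-y)^2}{4\Delta t_n}\}$; $s_+^{n+1}=s_+^n-\frac{\Delta t_n}{m}v^n_{N_+^n}$, $s_-^{n+1}=s_-^n+\frac{\Delta t_n}{m}v^n_{-N_-^n+1}$; $u_h^{n+1/2}=\pi_h^{n+1}u^{n+1/2}\in V_h^{n+1}$. (2) Parabolic step, for $u_t-u\,u_{xx}=mu^{q+1}$: $u_h^{n+1}\in V_h^{n+1}$ is the solution of, for all $\phi_h\in V_h^{n+1}$, $$(u_h^{n+1},\phi_h)_h+\Delta t_n\big((u_h^{n+1})_x,(u_h^{n+1/2}\phi_h)_x\big)=(u_h^{n+1/2},\phi_h)_h+mq\Delta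 t_n\big(\pi_h^{n+1}((u_h^{n+1/2})^qu_h^{n+1}),\phi_h\big)_h+m(1-q)\Delta t_n\big(\pi_h^{n+1}((u_h^{n+1/2})^{q+1}),\phi_h\big)_h,$$ where $(\cdot,\cdot)$ is the $L^2(\mathbb{R})$ scalar product and, with $a=-N_-^{n+1}+1$, $b=N_+^{n+1}-1$, $$(\phi_h,\psi_h)_h=\tfrac12(h_-^{n+1}+h)\phi_a\psi_a+h\sum_{i=a+1}^{b-1}\phi_i\psi_i+\tfrac12(h_+^{n+1}+h)\phi_b\psi_b .$$ "Exists at least until $T_1$" means that $u_h^n$ is well defined for every $n$ with $t_n<T_1$. *)

theory Defs
  imports "HOL-Analysis.Analysis" "HOL-Probability.Essential_Supremum"
begin

(* The norm of L^infinity(R), as a real number.  It is only applied to bounded Borel functions, so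
   the convention that real_of_ereal maps infinity to 0 plays no role. *)
definition linf_norm :: "(real \<Rightarrow> real) \<Rightarrow> real" where
  "linf_norm f = real_of_ereal (esssup lborel (\<lambda>x. ereal \<bar>f x\<bar>))"

definition l2_product :: "(real \<Rightarrow> real) \<Rightarrow> (real \<Rightarrow> real) \<Rightarrow> real" where
  "l2_product f g = (\<integral>x. f x * g x \<partial>lborel)"

record mesh =
  width :: real
  s_minus :: real
  s_plus :: real

definition N_minus :: "mesh \<Rightarrow> int" where
  "N_minus M = \<lfloor>s_minus M / width M\<rfloor>"

definition N_plus :: "mesh \<Rightarrow> int" where
  "N_plus M = \<lfloor>s_plus M / width M\<rfloor>"

definition h_minus :: "mesh \<Rightarrow> real" where
  "h_minus M = s_minus M - (of_int (N_minus M) - 1) * width M"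

definition h_plus :: "mesh \<Rightarrow> real" where
  "h_plus M = s_plus M - (of_int (N_plus M) - 1) * width M"

definition node :: "mesh \<Rightarrow> int \<Rightarrow> real" where
  "node M i = of_int i * width M"

definition first_node :: "mesh \<Rightarrow> int" where
  "first_node M = - N_minus M + 1"

definition last_node :: "mesh \<Rightarrow> int" where
  "last_node M = N_plus M - 1"

(* The cells are indexed by i in {- N_minus M + 1..N_plus M}: the two extreme indices give the end
   intervals (- s_minus, x_{- N_minus + 1}) and (x_{N_plus - 1}, s_plus), the others
   I_i = (x_{i-1}, x_i). *)
definition cell :: "mesh \<Rightarrow> int \<Rightarrow> real set" where
  "cell M i =
     {(if i = - N_minus M + 1 then - s_minus M else node M (i - 1))
      <..< (if i = N_plus M then s_plus M else node M i)}"

definition affine_on :: "real set \<Rightarrow> (real \<Rightarrow> real) \<Rightarrow> bool" where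
  "affine_on S f \<longleftrightarrow> (\<exists>c d. \<forall>x\<in>S. f x = c + d * x)"

definition V_h :: "mesh \<Rightarrow> (real \<Rightarrow> real) set" where
  "V_h M = {f. continuous_on UNIV f \<and>
               (\<forall>x. x \<notin> {- s_minus M<..<s_plus M} \<longrightarrow> f x = 0) \<and>
               (\<forall>i\<in>{- N_minus M + 1..N_plus M}. affine_on (cell M i) f)}"

definition lagrange :: "mesh \<Rightarrow> (real \<Rightarrow> real) \<Rightarrow> (real \<Rightarrow> real)" where
  "lagrange M f =
     (THE g. g \<in> V_h M \<and> (\<forall>i\<in>{first_node M..last_node M}. g (node M i) = f (node M i)))"

definition slope :: "mesh \<Rightarrow> (real \<Rightarrow> real) \<Rightarrow> int \<Rightarrow> real" where
  "slope M u i =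
     (if i = N_plus M then - u (node M (N_plus M - 1)) / h_plus M
      else if i = - N_minus M + 1 then u (node M (- N_minus M + 1)) / h_minus M
      else (u (node M i) - u (node M (i - 1))) / width M)"

(* The piecewise constant derivative; its value 0 at the finitely many end points of the cells is
   irrelevant. *)
definition discrete_deriv :: "mesh \<Rightarrow> (real \<Rightarrow> real) \<Rightarrow> (real \<Rightarrow> real)" where
  "discrete_deriv M u x =
     (\<Sum>i\<in>{- N_minus M + 1..N_plus M}. slope M u i * indicator (cell M i) x)"

definition lumped_product :: "mesh \<Rightarrow> (real \<Rightarrow> real) \<Rightarrow> (real \<Rightarrow> real) \<Rightarrow> real" where
  "lumped_product M f g =
     (let a = first_node M; b = last_node M in
        1 / 2 * (h_minus M + width M) * f (node M a) * g (node M a)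
        + width M * (\<Sum>i\<in>{a + 1..b - 1}. f (node M i) * g (node M i))
        + 1 / 2 * (h_plus M + width M) * f (node M b) * g (node M b))"

(* The supremum is finite because the function u is always a bounded one here. *)
definition hopf_lax :: "real \<Rightarrow> real \<Rightarrow> (real \<Rightarrow> real) \<Rightarrow> (real \<Rightarrow> real)" where
  "hopf_lax m \<tau> u x = (SUP y. u y - m * (x - y)\<^sup>2 / (4 * \<tau>))"

definition next_mesh :: "real \<Rightarrow> real \<Rightarrow> mesh \<Rightarrow> (real \<Rightarrow> real) \<Rightarrow> mesh" where
  "next_mesh m \<tau> M u =
     \<lparr>width = width M,
      s_minus = s_minus M + \<tau> / m * slope M u (- N_minus M + 1),
      s_plus = s_plus M - \<tau> / m * slope M u (N_plus M)\<rparr>"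

definition half_step :: "real \<Rightarrow> real \<Rightarrow> mesh \<Rightarrow> (real \<Rightarrow> real) \<Rightarrow> (real \<Rightarrow> real)" where
  "half_step m \<tau> M u = lagrange (next_mesh m \<tau> M u) (hopf_lax m \<tau> u)"

(* w is the result of the hyperbolic step.  The functions differentiated are continuous and
   piecewise polynomial, so their weak derivatives are given by the classical one, which exists
   outside the finitely many end points of the cells; the value of deriv there is irrelevant. *)
definition parabolic_solution ::
    "real \<Rightarrow> real \<Rightarrow> real \<Rightarrow> mesh \<Rightarrow> (real \<Rightarrow> real) \<Rightarrow> (real \<Rightarrow> real) \<Rightarrow> bool" where
  "parabolic_solution m q \<tau> M w u \<longleftrightarrow>
     u \<in> V_h M \<and>
     (\<forall>\<phi>\<in>V_h M.
        lumped_product M u \<phi> + \<tau> * l2_product (deriv u) (deriv (\<lambda>x. w x * \<phi> x))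
        = lumped_product M w \<phi>
          + m * q * \<tau> * lumped_product M (lagrange M (\<lambda>x. w x powr q * u x)) \<phi>
          + m * (1 - q) * \<tau> * lumped_product M (lagrange M (\<lambda>x. w x powr (q + 1))) \<phi>)"

type_synonym level = "mesh \<times> (real \<Rightarrow> real)"

(* One time step of length \<tau>.  The result is None, i.e. the next iterate is not well defined,
   unless the parabolic problem has exactly one solution. *)
definition scheme_step :: "real \<Rightarrow> real \<Rightarrow> real \<Rightarrow> level \<Rightarrow> level option" where
  "scheme_step m q \<tau> L =
     (case L of (M, u) \<Rightarrow>
        let M' = next_mesh m \<tau> M u;
            P = parabolic_solution m q \<tau> M' (half_step m \<tau> M u)
        in if \<exists>!u'. P u' then Some (M', THE u'. P u') else None)"

definition initial_mesh :: "real \<Rightarrow> nat \<Rightarrow> mesh" where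
  "initial_mesh s0 N = \<lparr>width = s0 / real N, s_minus = s0, s_plus = s0\<rparr>"

(* numerical_solution m q s0 N u0 \<tau> n is Some (M, u), where M describes the mesh of level n and
   u is the iterate u_h^n, if u_h^n is well defined for the time steps \<tau> 0, \<tau> 1, ..., and
   None otherwise. *)
primrec numerical_solution ::
    "real \<Rightarrow> real \<Rightarrow> real \<Rightarrow> nat \<Rightarrow> (real \<Rightarrow> real) \<Rightarrow> (nat \<Rightarrow> real) \<Rightarrow> nat \<Rightarrow> level option" where
  "numerical_solution m q s0 N u0 \<tau> 0 =
     Some (initial_mesh s0 N, lagrange (initial_mesh s0 N) u0)"
| "numerical_solution m q s0 N u0 \<tau> (Suc n) =
     Option.bind (numerical_solution m q s0 N u0 \<tau> n) (scheme_step m q (\<tau> n))"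

definition time_level :: "(nat \<Rightarrow> real) \<Rightarrow> nat \<Rightarrow> real" where
  "time_level \<tau> n = (\<Sum>k<n. \<tau> k)"

end

(* Testing the parabolic step with nodal hat functions turns it into a tridiagonal linear system for
   the nodal values whose matrix is a strictly diagonally dominant M-matrix as long as
   m q dt C^q < 1, where C bounds w = u_h^(n+1/2).  Hence it is uniquely solvable, and comparison
   with constants gives 0 <= u_h^(n+1) <= C (1 + m (1-q) dt C^q) / (1 - m q dt C^q).  Hopf-Lax
   followed by interpolation does not increase the maximum, so C can be taken to be the bound of
   level n.  By Bernoulli's inequality (1-y)^(-(1-q)/q) >= 1 + (1-q)/q y with y = m q dt C^q, the
   new bound is at most C (1-y)^(-1/q), i.e. C^(-q) decreases by at most m q dt, which is exactly
   the decrease of U^(-q) - m q t in the claimed estimate. *)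

theory Submission
  imports Defs
begin

text \<open>The matrix has the right signs because of how the stiffness term pairs u_x with (w
  phi)_x. On each cell u_x is constant, so the integral is exactly slope times increment of w phi,
  although w phi is quadratic. Summation by parts then puts the single weight w(x_i) in front of the
  slope jump of u at x_i. Row i is therefore a positive reaction coefficient plus w(x_i) times a
  negative second difference. The matrix is not symmetric in general, but w >= 0 at the nodes is all
  that its signs require, and zeros of w are harmless.

  The claimed bound is the exact solution of C' = m C^(q+1), which blows up at T_1. With C its value
  at t_n, the condition m q dt C^q < 1 says precisely that t_(n+1) < T_1. Solving the step needs the
  bound of the previous level, so existence and bound are proved in one induction.\<close>

section \<open>Finite linear systems\<close>

text \<open>Elimination of one unknown \<open>k\<close>: the rows in \<open>S\<close> are solved by
  \<open>y + c * z\<close>, and row \<open>k\<close> becomes a scalar equation for \<open>c\<close>.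
  The right-hand side \<open>b\<close> stays arbitrary in the induction because the smaller system
  is solved for two different ones.\<close>

lemma diag_dominant_solvable:
  fixes A :: "'a \<Rightarrow> 'a \<Rightarrow> real"
  assumes "finite S" and "\<And>i. i \<in> S \<Longrightarrow> (\<Sum>j\<in>S - {i}. \<bar>A i j\<bar>) < \<bar>A i i\<bar>"
  shows "\<exists>x. \<forall>i\<in>S. (\<Sum>j\<in>S. A i j * x j) = b i"
  using assms
proof (induction S arbitrary: b rule: finite_induct)
  case empty
  then show ?case by simp
next
  case (insert k S)
  have dom: "(\<Sum>j\<in>S - {i}. \<bar>A i j\<bar>) + \<bar>A i k\<bar> < \<bar>A i i\<bar>" if "i \<in> S" for i
  proof -
    have "insert k S - {i} = insert k (S - {i})" "k \<notin> S - {i}"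
      using that insert.hyps by auto
    then show ?thesis
      using insert.prems[of i] that insert.hyps(1) by simp
  qed
  have sub: "\<And>i. i \<in> S \<Longrightarrow> (\<Sum>j\<in>S - {i}. \<bar>A i j\<bar>) < \<bar>A i i\<bar>"
    using dom by (smt (verit) abs_ge_zero)
  obtain y where y: "\<And>i. i \<in> S \<Longrightarrow> (\<Sum>j\<in>S. A i j * y j) = b i"
    using insert.IH[OF sub] by blast
  \<comment> \<open>\<open>z\<close> is the response of the unknowns in \<open>S\<close> to the
    value 1 of unknown \<open>k\<close>.\<close>
  obtain z where z: "\<And>i. i \<in> S \<Longrightarrow> (\<Sum>j\<in>S. A i j * z j) = - A i k"
    using insert.IH[OF sub, of "\<lambda>i. - A i k"] by blast
  \<comment> \<open>At an index where |z| is largest, a value above 1 would contradict dominance of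
    that row with its entry in column \<open>k\<close> included.\<close>
  have z1: "\<bar>z j\<bar> \<le> 1" if "j \<in> S" for j
  proof -
    have "finite ((\<lambda>j. \<bar>z j\<bar>) ` S)" "(\<lambda>j. \<bar>z j\<bar>) ` S \<noteq> {}"
      using insert.hyps(1) that by auto
    then obtain i where i: "i \<in> S" and "Max ((\<lambda>j. \<bar>z j\<bar>) ` S) = \<bar>z i\<bar>"
      by (meson Max_in imageE)
    then have max: "\<bar>z l\<bar> \<le> \<bar>z i\<bar>" if "l \<in> S" for l
      using Max_ge[of "(\<lambda>j. \<bar>z j\<bar>) ` S" "\<bar>z l\<bar>"] that insert.hyps(1) by auto
    have "\<bar>z i\<bar> \<le> 1"
    proof (rule ccontr)
      assume big: "\<not> \<bar>z i\<bar> \<le> 1"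
      have "A i i * z i = - A i k - (\<Sum>j\<in>S - {i}. A i j * z j)"
        using z[OF i] sum.remove[OF insert.hyps(1) i, of "\<lambda>j. A i j * z j"] by linarith
      then have "\<bar>A i i\<bar> * \<bar>z i\<bar> \<le> \<bar>A i k\<bar> + \<bar>\<Sum>j\<in>S - {i}. A i j * z j\<bar>"
        by (metis abs_minus_cancel abs_mult abs_triangle_ineq4)
      also have "\<bar>\<Sum>j\<in>S - {i}. A i j * z j\<bar> \<le> (\<Sum>j\<in>S - {i}. \<bar>A i j\<bar> * \<bar>z i\<bar>)"
        by (rule order_trans[OF sum_abs]) (auto intro!: sum_mono mult_left_mono max simp: abs_mult)
      also have "\<bar>A i k\<bar> + (\<Sum>j\<in>S - {i}. \<bar>A i j\<bar> * \<bar>z i\<bar>)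
          \<le> \<bar>A i k\<bar> * \<bar>z i\<bar> + (\<Sum>j\<in>S - {i}. \<bar>A i j\<bar>) * \<bar>z i\<bar>"
        using big mult_left_mono[of 1 "\<bar>z i\<bar>" "\<bar>A i k\<bar>"] by (simp add: sum_distrib_right)
      also have "\<dots> = ((\<Sum>j\<in>S - {i}. \<bar>A i j\<bar>) + \<bar>A i k\<bar>) * \<bar>z i\<bar>"
        by (simp add: algebra_simps)
      also have "\<dots> < \<bar>A i i\<bar> * \<bar>z i\<bar>"
        using dom[OF i] big by (intro mult_strict_right_mono) auto
      finally show False by simp
    qed
    then show ?thesis
      using max[OF that] by linarith
  qed
  \<comment> \<open>\<open>A k k + t\<close> is the Schur complement of the \<open>S\<close> block;
    |z| <= 1 and dominance of row \<open>k\<close> keep it away from 0.\<close>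
  define t where "t = (\<Sum>j\<in>S. A k j * z j)"
  have "\<bar>t\<bar> \<le> (\<Sum>j\<in>S. \<bar>A k j\<bar> * 1)"
    unfolding t_def
    by (rule order_trans[OF sum_abs]) (auto intro!: sum_mono mult_left_mono z1 simp: abs_mult simp del: mult_1_right)
  also have "\<dots> < \<bar>A k k\<bar>"
    using insert.prems[of k] insert.hyps by simp
  finally have nz: "A k k + t \<noteq> 0" by linarith
  define c where "c = (b k - (\<Sum>j\<in>S. A k j * y j)) / (A k k + t)"
  define x where "x = (\<lambda>j. if j = k then c else y j + c * z j)"
  have xsum: "(\<Sum>j\<in>insert k S. A i j * x j)
      = A i k * c + (\<Sum>j\<in>S. A i j * y j) + c * (\<Sum>j\<in>S. A i j * z j)" for i
  proof -
    have "(\<Sum>j\<in>S. A i j * x j) = (\<Sum>j\<in>S. A i j * y j + c * (A i j * z j))"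
      using insert.hyps by (intro sum.cong) (auto simp: x_def algebra_simps)
    then show ?thesis
      using insert.hyps by (simp add: x_def sum.distrib sum_distrib_left)
  qed
  have "(\<Sum>j\<in>insert k S. A i j * x j) = b i" if "i \<in> insert k S" for i
  proof (cases "i = k")
    case True
    have "c * (A k k + t) = b k - (\<Sum>j\<in>S. A k j * y j)"
      using nz by (simp add: c_def)
    then show ?thesis
      unfolding xsum True t_def by (simp add: algebra_simps)
  next
    case False
    then show ?thesis
      unfolding xsum using that y z by simp
  qed
  then show ?case by blast
qed

text \<open>Extending \<open>x\<close> by 0 outside \<open>{a..b}\<close> supplies the missing
  neighbours of the first and last rows, so that all rows have one form.\<close>

lemma tridiagonal_solvable:
  fixes a b :: int and d l r f :: "int \<Rightarrow> real"
  assumes dom: "\<And>i. i \<in> {a..b} \<Longrightarrow> l i \<ge> 0 \<and> r i \<ge> 0 \<and> l i + r i < d i"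
  shows "\<exists>x. (\<forall>i. i \<notin> {a..b} \<longrightarrow> x i = 0) \<and>
             (\<forall>i\<in>{a..b}. d i * x i - l i * x (i - 1) - r i * x (i + 1) = f i)"
proof -
  define A where "A = (\<lambda>i j. (if j = i then d i else 0) - (if j = i - 1 then l i else 0)
                              - (if j = i + 1 then r i else 0))"
  have diag: "(\<Sum>j\<in>{a..b} - {i}. \<bar>A i j\<bar>) < \<bar>A i i\<bar>" if "i \<in> {a..b}" for i
  proof -
    have "(\<Sum>j\<in>{a..b} - {i}. \<bar>A i j\<bar>)
        \<le> (\<Sum>j\<in>{a..b} - {i}. (if j = i - 1 then l i else 0) + (if j = i + 1 then r i else 0))"
      using dom[OF that] by (intro sum_mono) (auto simp: A_def)
    also have "\<dots> \<le> l i + r i"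
      using dom[OF that] by (simp add: sum.distrib)
    finally show ?thesis
      using dom[OF that] by (simp add: A_def)
  qed
  obtain x where x: "\<And>i. i \<in> {a..b} \<Longrightarrow> (\<Sum>j\<in>{a..b}. A i j * x j) = f i"
    using diag_dominant_solvable[OF finite_atLeastAtMost_int diag] by blast
  define y where "y = (\<lambda>i. if i \<in> {a..b} then x i else 0)"
  have "d i * y i - l i * y (i - 1) - r i * y (i + 1) = f i" if "i \<in> {a..b}" for i
  proof -
    have "(\<Sum>j\<in>{a..b}. A i j * x j) = (\<Sum>j\<in>{a..b}. (if j = i then d i * y j else 0)
        - (if j = i - 1 then l i * y j else 0) - (if j = i + 1 then r i * y j else 0))"
      by (intro sum.cong) (auto simp: A_def y_def)
    also have "\<dots> = d i * y i - l i * y (i - 1) - r i * y (i + 1)"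
      using that by (simp add: sum_subtractf y_def)
    finally show ?thesis
      using x[OF that] by simp
  qed
  then show ?thesis
    by (intro exI[of _ y]) (auto simp: y_def)
qed

text \<open>At a negative minimum both difference terms are nonpositive and the term with
  \<open>c\<close> is strictly negative, contradicting the inequality of that row. The nonnegative
  boundary values keep such a minimum inside.\<close>

lemma discrete_min_principle:
  fixes a b :: int and c l r v :: "int \<Rightarrow> real"
  assumes bd: "v (a - 1) \<ge> 0" "v (b + 1) \<ge> 0"
    and ineq: "\<And>i. i \<in> {a..b} \<Longrightarrow> c i > 0 \<and> l i \<ge> 0 \<and> r i \<ge> 0 \<and>
      c i * v i + l i * (v i - v (i - 1)) - r i * (v (i + 1) - v i) \<ge> 0"
    and j: "j \<in> {a..b}"
  shows "v j \<ge> 0"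
proof (rule ccontr)
  assume neg: "\<not> v j \<ge> 0"
  have "finite (v ` {a..b})" "v ` {a..b} \<noteq> {}"
    using j by auto
  then obtain i where i: "i \<in> {a..b}" and "Min (v ` {a..b}) = v i"
    by (meson Min_in imageE)
  then have min: "v i \<le> v k" if "k \<in> {a..b}" for k
    using that by (metis Min_le finite_atLeastAtMost_int finite_imageI imageI)
  have vi: "v i < 0"
    using min[OF j] neg by linarith
  have le: "v i \<le> v k" if "k \<in> {a - 1..b + 1}" for k
  proof -
    have "k = a - 1 \<or> k = b + 1 \<or> k \<in> {a..b}"
      using that by auto
    then show ?thesis
      using min vi bd by fastforce
  qed
  have "v i \<le> v (i - 1)" "v i \<le> v (i + 1)"
    using i by (auto intro!: le)
  then have "l i * (v i - v (i - 1)) \<le> 0" "r i * (v (i + 1) - v i) \<ge> 0"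
    using ineq[OF i] by (simp_all add: mult_nonneg_nonpos)
  moreover have "c i * v i < 0"
    using ineq[OF i] vi by (simp add: mult_pos_neg)
  ultimately show False
    using ineq[OF i] by linarith
qed

text \<open>Turns the cellwise stiffness form into a nodal one; \<open>p\<close> will be the product
  of w and a test function, which vanishes at both ends of the support.\<close>

lemma sum_by_parts_zero_boundary:
  fixes s p :: "int \<Rightarrow> real"
  assumes "A < B" and "p A = 0" and "p B = 0"
  shows "(\<Sum>i\<in>{A + 1..B}. s i * (p i - p (i - 1))) = (\<Sum>i\<in>{A + 1..B - 1}. (s i - s (i + 1)) * p i)"
proof -
  have "(\<Sum>i\<in>{A + 1..B}. s i * p i) = (\<Sum>i\<in>{A + 1..B - 1}. s i * p i)"
    using assms by (intro sum.mono_neutral_right) (auto simp: not_le)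
  moreover have "(\<Sum>i\<in>{A + 1..B}. s i * p (i - 1)) = (\<Sum>i\<in>{A..B - 1}. s (i + 1) * p i)"
    by (rule sum.reindex_bij_witness[of _ "\<lambda>i. i + 1" "\<lambda>i. i - 1"]) auto
  moreover have "(\<Sum>i\<in>{A..B - 1}. s (i + 1) * p i) = (\<Sum>i\<in>{A + 1..B - 1}. s (i + 1) * p i)"
    using assms by (intro sum.mono_neutral_right) (auto simp: not_le)
  ultimately show ?thesis
    by (simp add: algebra_simps sum_subtractf sum.distrib)
qed

section \<open>Piecewise affine functions\<close>

text \<open>The two extreme grid points are replaced by the ends of the support. Every cell,
  including the wider end cells, is then the interval from \<open>breakpoint M (i - 1)\<close> to
  \<open>breakpoint M i\<close>, without case distinctions.\<close>

definition breakpoint :: "mesh \<Rightarrow> int \<Rightarrow> real" where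
  "breakpoint M i =
     (if i = - N_minus M then - s_minus M else if i = N_plus M then s_plus M else node M i)"

text \<open>The factor 2 comes from \<open>N >= 2\<close> on the initial mesh and survives because
  the support only expands. It makes the first and last nodes distinct, with node 0 strictly between
  them.\<close>

locale admissible_mesh =
  fixes M :: mesh
  assumes width_pos: "width M > 0"
    and s_minus_ge: "s_minus M \<ge> 2 * width M"
    and s_plus_ge: "s_plus M \<ge> 2 * width M"
begin

abbreviation "A \<equiv> - N_minus M"
abbreviation "B \<equiv> N_plus M"
abbreviation "p \<equiv> breakpoint M"

lemma N_minus_ge: "N_minus M \<ge> 2"
  using width_pos s_minus_ge by (simp add: N_minus_def le_floor_iff field_simps)

lemma N_plus_ge: "N_plus M \<ge> 2"
  using width_pos s_plus_ge by (simp add: N_plus_def le_floor_iff field_simps)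

lemma nodes_nonempty: "first_node M < 0" "0 < last_node M"
  using N_minus_ge N_plus_ge by (auto simp: first_node_def last_node_def)

lemma node_gt_left: "- s_minus M < node M i" if "A < i"
proof -
  have "of_int (N_minus M) * width M \<le> s_minus M"
    using width_pos by (simp add: N_minus_def floor_divide_lower)
  moreover have "- of_int (N_minus M) * width M < of_int i * width M"
    using width_pos that by (intro mult_strict_right_mono) linarith+
  ultimately show ?thesis
    by (simp add: node_def)
qed

lemma node_lt_right: "node M i < s_plus M" if "i < B"
proof -
  have "of_int (N_plus M) * width M \<le> s_plus M"
    using width_pos by (simp add: N_plus_def floor_divide_lower)
  moreover have "of_int i * width M < of_int (N_plus M) * width M"
    using width_pos that by (intro mult_strict_right_mono) linarith+
  ultimately show ?thesis
    by (simp add: node_def)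
qed

lemma breakpoint_left [simp]: "p A = - s_minus M"
  by (simp add: breakpoint_def)

lemma breakpoint_right [simp]: "p B = s_plus M"
  using N_minus_ge N_plus_ge by (simp add: breakpoint_def)

lemma breakpoint_inner: "p i = node M i" if "i \<in> {first_node M..last_node M}"
  using that by (auto simp: breakpoint_def first_node_def last_node_def)

lemma breakpoint_less: "p i < p j" if "A \<le> i" "i < j" "j \<le> B"
proof -
  have "node M i < node M j"
    using width_pos that by (simp add: node_def)
  moreover have "- s_minus M < s_plus M"
    using width_pos s_minus_ge s_plus_ge by linarith
  ultimately show ?thesis
    using that node_gt_left node_lt_right by (auto simp: breakpoint_def)
qed

lemma breakpoint_le: "p i \<le> p j" if "A \<le> i" "i \<le> j" "j \<le> B"
  using breakpoint_less[of i j] that by (cases "i = j") auto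

lemma cell_pos: "p (i - 1) < p i" if "i \<in> {A + 1..B}"
  using that by (intro breakpoint_less) auto

lemma end_widths_pos: "h_minus M > 0" "h_plus M > 0"
proof -
  have "h_minus M = p (A + 1) - p A" "h_plus M = p B - p (B - 1)"
    using N_minus_ge N_plus_ge
    by (auto simp: breakpoint_def h_minus_def h_plus_def node_def algebra_simps)
  moreover have "p A < p (A + 1)" "p (B - 1) < p B"
    using N_minus_ge N_plus_ge by (auto intro!: breakpoint_less simp del: breakpoint_left breakpoint_right)
  ultimately show "h_minus M > 0" "h_plus M > 0"
    by linarith+
qed

lemma cell_eq: "cell M i = {p (i - 1)<..<p i}" if "i \<in> {A + 1..B}"
  using that by (auto simp: cell_def breakpoint_def)

lemma cells_cover:
  assumes "x \<in> {- s_minus M..s_plus M}"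
  obtains i where "i \<in> {A + 1..B}" "x \<in> {p (i - 1)..p i}"
proof -
  \<comment> \<open>Induction over the right end \<open>p i\<close> of the part already covered; the
    claim is the case \<open>i = B\<close>.\<close>
  have "\<forall>i. A + 1 \<le> i \<longrightarrow> i \<le> B \<longrightarrow> x \<le> p i \<longrightarrow> (\<exists>i\<in>{A + 1..B}. x \<in> {p (i - 1)..p i})"
  proof (rule allI, rule impI)
    fix i assume "A + 1 \<le> i"
    then show "i \<le> B \<longrightarrow> x \<le> p i \<longrightarrow> (\<exists>i\<in>{A + 1..B}. x \<in> {p (i - 1)..p i})"
    proof (induction i rule: int_ge_induct)
      case base
      then show ?case
        using assms by (auto intro!: bexI[of _ "A + 1"])
    next
      case (step i)
      then show ?case
        by (cases "x \<le> p i") (auto intro!: bexI[of _ "i + 1"])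
    qed
  qed
  from this[rule_format, of B] show ?thesis
    using that assms N_minus_ge N_plus_ge by auto
qed

lemma cells_disjoint:
  assumes "i \<in> {A + 1..B}" "j \<in> {A + 1..B}" "x \<in> {p (i - 1)<..<p i}" "x \<in> {p (j - 1)<..<p j}"
  shows "i = j"
proof (rule ccontr)
  assume "i \<noteq> j"
  then consider "i \<le> j - 1" | "j \<le> i - 1" by linarith
  then show False
    using breakpoint_le[of i "j - 1"] breakpoint_le[of j "i - 1"] assms by cases auto
qed

text \<open>The zero values at the ends of the support make the two special end formulas of
  \<open>slope\<close> ordinary difference quotients.\<close>

lemma slope_eq: "slope M u i = (u (p i) - u (p (i - 1))) / (p i - p (i - 1))"
  if i: "i \<in> {A + 1..B}" and u: "u (- s_minus M) = 0" "u (s_plus M) = 0"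
proof -
  consider "i = B" | "i = A + 1" | "A + 1 < i" "i < B"
    using i by force
  then show ?thesis
  proof cases
    case 1
    have "p (B - 1) = node M (B - 1)" "h_plus M = s_plus M - node M (B - 1)"
      using N_minus_ge N_plus_ge by (auto simp: breakpoint_def h_plus_def node_def)
    then show ?thesis
      using u by (simp add: 1 slope_def)
  next
    case 2
    have "p (A + 1) = node M (A + 1)" "h_minus M = node M (A + 1) + s_minus M"
      using N_minus_ge N_plus_ge by (auto simp: breakpoint_def h_minus_def node_def algebra_simps)
    moreover have "A + 1 \<noteq> B"
      using N_minus_ge N_plus_ge by linarith
    ultimately show ?thesis
      using u unfolding 2 slope_def by simp
  next
    case 3
    then have "p i = node M i" "p (i - 1) = node M (i - 1)"
      by (auto simp: breakpoint_def)
    moreover have "node M i - node M (i - 1) = width M"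
      by (simp add: node_def algebra_simps)
    ultimately show ?thesis
      using 3 by (simp add: slope_def)
  qed
qed

lemma V_h_outside: "u x = 0" if "u \<in> V_h M" "x \<le> - s_minus M \<or> s_plus M \<le> x"
  using that by (auto simp: V_h_def)

lemma V_h_slope: "slope M u i = (u (p i) - u (p (i - 1))) / (p i - p (i - 1))"
  if "u \<in> V_h M" "i \<in> {A + 1..B}"
  using that by (intro slope_eq) (auto simp: V_h_outside)

text \<open>Membership in \<open>V_h\<close> gives an affine formula on the open cell only;
  continuity carries it to the closure, so that it can be evaluated at the breakpoints.\<close>

lemma V_h_affine:
  assumes u: "u \<in> V_h M" and i: "i \<in> {A + 1..B}" and x: "x \<in> {p (i - 1)..p i}"
  shows "u x = u (p (i - 1)) + slope M u i * (x - p (i - 1))"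
proof -
  have "continuous_on UNIV u" "affine_on (cell M i) u"
    using u i by (auto simp: V_h_def)
  then obtain c d where cd: "\<And>x. x \<in> {p (i - 1)<..<p i} \<Longrightarrow> u x = c + d * x"
    unfolding affine_on_def cell_eq[OF i] by blast
  have "closed {x. u x = c + d * x}"
    using \<open>continuous_on UNIV u\<close> by (intro closed_Collect_eq continuous_intros)
  then have "closure {p (i - 1)<..<p i} \<subseteq> {x. u x = c + d * x}"
    using cd by (intro closure_minimal) auto
  then have eq: "\<And>x. x \<in> {p (i - 1)..p i} \<Longrightarrow> u x = c + d * x"
    using cell_pos[OF i] by auto
  have e: "u (p (i - 1)) = c + d * p (i - 1)" "u (p i) = c + d * p i"
    using cell_pos[OF i] by (auto intro: eq)
  have "slope M u i = d"
    unfolding V_h_slope[OF u i] e using cell_pos[OF i] by (simp add: field_simps)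
  then show ?thesis
    using eq[OF x] e by (simp add: algebra_simps)
qed

text \<open>On a cell the function is a convex combination of its two breakpoint values, and at the
  ends of the support these are 0, which also lies in the interval.\<close>

lemma V_h_bounds:
  assumes u: "u \<in> V_h M" and "0 \<le> C"
    and nodes: "\<And>i. i \<in> {first_node M..last_node M} \<Longrightarrow> u (node M i) \<in> {0..C}"
  shows "u x \<in> {0..C}"
proof (cases "x \<in> {- s_minus M..s_plus M}")
  case True
  then obtain i where i: "i \<in> {A + 1..B}" and x: "x \<in> {p (i - 1)..p i}"
    by (rule cells_cover)
  have bp: "u (p j) \<in> {0..C}" if "j \<in> {A..B}" for j
  proof -
    have "j = A \<or> j = B \<or> j \<in> {first_node M..last_node M}"
      using that by (auto simp: first_node_def last_node_def)
    then show ?thesis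
      using nodes V_h_outside[OF u] \<open>0 \<le> C\<close> by (auto simp: breakpoint_inner)
  qed
  define t where "t = (x - p (i - 1)) / (p i - p (i - 1))"
  have t: "0 \<le> t" "t \<le> 1"
    using x cell_pos[OF i] by (auto simp: t_def)
  have ux: "u x = (1 - t) * u (p (i - 1)) + t * u (p i)"
    unfolding V_h_affine[OF u i x] V_h_slope[OF u i] t_def
    by (simp add: algebra_simps diff_divide_distrib)
  have "u (p (i - 1)) \<in> {0..C}" "u (p i) \<in> {0..C}"
    using i bp[of "i - 1"] bp[of i] by auto
  then have "(1 - t) *\<^sub>R u (p (i - 1)) + t *\<^sub>R u (p i) \<in> {0..C}"
    using t by (intro convexD_alt convex_real_interval) auto
  then show ?thesis
    by (simp add: ux)
next
  case False
  then show ?thesis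
    using V_h_outside[OF u, of x] \<open>0 \<le> C\<close> by auto
qed

lemma V_h_eqI:
  assumes "u \<in> V_h M" "v \<in> V_h M"
    and nodes: "\<And>i. i \<in> {first_node M..last_node M} \<Longrightarrow> u (node M i) = v (node M i)"
  shows "u = v"
proof
  fix x
  have bp: "u (p j) = v (p j)" if "j \<in> {A..B}" for j
  proof -
    have "j = A \<or> j = B \<or> j \<in> {first_node M..last_node M}"
      using that by (auto simp: first_node_def last_node_def)
    then show ?thesis
      using nodes V_h_outside[OF assms(1)] V_h_outside[OF assms(2)] by (auto simp: breakpoint_inner)
  qed
  show "u x = v x"
  proof (cases "x \<in> {- s_minus M..s_plus M}")
    case True
    then obtain i where i: "i \<in> {A + 1..B}" and x: "x \<in> {p (i - 1)..p i}"
      by (rule cells_cover)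
    have "u (p (i - 1)) = v (p (i - 1))" "u (p i) = v (p i)"
      using i bp[of "i - 1"] bp[of i] by auto
    then show ?thesis
      using assms(1,2) i by (simp add: V_h_affine[OF _ i x] V_h_slope)
  next
    case False
    then show ?thesis
      using V_h_outside[of u x] V_h_outside[of v x] assms by auto
  qed
qed

text \<open>The nodal basis function, written as a truncated minimum of two lines so that continuity
  is immediate; the formulas on the single cells are derived afterwards. Only indices in
  \<open>{A + 1..B - 1}\<close> are meant.\<close>

definition hat :: "int \<Rightarrow> real \<Rightarrow> real" where
  "hat i x = max 0 (min ((x - p (i - 1)) / (p i - p (i - 1))) ((p (i + 1) - x) / (p (i + 1) - p i)))"

lemma hat_left_of:
  assumes "i \<in> {A + 1..B - 1}" "x \<le> p (i - 1)"
  shows "hat i x = 0"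
proof -
  have "(x - p (i - 1)) / (p i - p (i - 1)) \<le> 0"
    using assms cell_pos[of i] by (intro divide_nonpos_pos) auto
  then show ?thesis
    by (simp add: hat_def)
qed

lemma hat_right_of:
  assumes "i \<in> {A + 1..B - 1}" "p (i + 1) \<le> x"
  shows "hat i x = 0"
proof -
  have "(p (i + 1) - x) / (p (i + 1) - p i) \<le> 0"
    using assms cell_pos[of "i + 1"] by (intro divide_nonpos_pos) auto
  then show ?thesis
    by (simp add: hat_def)
qed

lemma hat_up:
  assumes "i \<in> {A + 1..B - 1}" "x \<in> {p (i - 1)..p i}"
  shows "hat i x = (x - p (i - 1)) / (p i - p (i - 1))"
proof -
  have d: "p (i - 1) < p i" "p i < p (i + 1)"
    using assms(1) cell_pos[of i] cell_pos[of "i + 1"] by auto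
  then have "(x - p (i - 1)) / (p i - p (i - 1)) \<le> 1" "0 \<le> (x - p (i - 1)) / (p i - p (i - 1))"
    "1 \<le> (p (i + 1) - x) / (p (i + 1) - p i)"
    using assms(2) by auto
  then show ?thesis
    by (simp add: hat_def)
qed

lemma hat_down:
  assumes "i \<in> {A + 1..B - 1}" "x \<in> {p i..p (i + 1)}"
  shows "hat i x = (p (i + 1) - x) / (p (i + 1) - p i)"
proof -
  have d: "p (i - 1) < p i" "p i < p (i + 1)"
    using assms(1) cell_pos[of i] cell_pos[of "i + 1"] by auto
  then have "(p (i + 1) - x) / (p (i + 1) - p i) \<le> 1" "0 \<le> (p (i + 1) - x) / (p (i + 1) - p i)"
    "1 \<le> (x - p (i - 1)) / (p i - p (i - 1))"
    using assms(2) by auto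
  then show ?thesis
    by (simp add: hat_def)
qed

lemma hat_in_V_h: "hat i \<in> V_h M" if i: "i \<in> {A + 1..B - 1}"
proof -
  have "continuous_on UNIV (hat i)"
    unfolding hat_def[abs_def] using that cell_pos[of i] cell_pos[of "i + 1"]
    by (intro continuous_intros) auto
  moreover have "hat i x = 0" if "x \<notin> {- s_minus M<..<s_plus M}" for x
  proof -
    have "p A \<le> p (i - 1)" "p (i + 1) \<le> p B"
      using i by (auto intro!: breakpoint_le simp del: breakpoint_left breakpoint_right)
    then show ?thesis
      using that hat_left_of[OF i, of x] hat_right_of[OF i, of x] by auto
  qed
  moreover have "affine_on (cell M j) (hat i)" if j: "j \<in> {A + 1..B}" for j
  proof -
    consider "j < i" | "j = i" | "j = i + 1" | "i + 1 < j" by linarith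
    then show ?thesis
    proof cases
      case 1
      then have "p j \<le> p (i - 1)"
        using i j by (intro breakpoint_le) auto
      then show ?thesis
        unfolding affine_on_def cell_eq[OF j]
        by (intro exI[of _ 0]) (auto intro!: hat_left_of[OF i])
    next
      case 2
      then show ?thesis
        unfolding affine_on_def cell_eq[OF j]
        by (intro exI[of _ "- p (i - 1) / (p i - p (i - 1))"] exI[of _ "1 / (p i - p (i - 1))"])
          (auto simp: hat_up[OF i] diff_divide_distrib)
    next
      case 3
      then show ?thesis
        unfolding affine_on_def cell_eq[OF j]
        by (intro exI[of _ "p (i + 1) / (p (i + 1) - p i)"] exI[of _ "- 1 / (p (i + 1) - p i)"])
          (auto simp: hat_down[OF i] diff_divide_distrib)
    next
      case 4
      then have "p (i + 1) \<le> p (j - 1)"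
        using i j by (intro breakpoint_le) auto
      then show ?thesis
        unfolding affine_on_def cell_eq[OF j]
        by (intro exI[of _ 0]) (auto intro!: hat_right_of[OF i])
    qed
  qed
  ultimately show ?thesis
    by (auto simp: V_h_def)
qed

lemma hat_breakpoint: "hat i (p j) = (if i = j then 1 else 0)"
  if i: "i \<in> {A + 1..B - 1}" and j: "j \<in> {A..B}"
proof -
  have d: "p (i - 1) < p i" "p i < p (i + 1)"
    using i cell_pos[of i] cell_pos[of "i + 1"] by auto
  consider "j < i" | "j = i" | "i < j" by linarith
  then show ?thesis
  proof cases
    case 1
    then have "p j \<le> p (i - 1)"
      using i j by (intro breakpoint_le) auto
    then show ?thesis
      using 1 hat_left_of[OF i] by auto
  next
    case 2
    then show ?thesis
      using d hat_up[OF i, of "p i"] by auto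
  next
    case 3
    then have "p (i + 1) \<le> p j"
      using i j by (intro breakpoint_le) auto
    then show ?thesis
      using 3 hat_right_of[OF i] by auto
  qed
qed

lemma affine_on_sum:
  assumes "\<And>i. i \<in> I \<Longrightarrow> affine_on S (f i)"
  shows "affine_on S (\<lambda>x. \<Sum>i\<in>I. c i * f i x)"
proof -
  obtain a b where ab: "\<And>i x. i \<in> I \<Longrightarrow> x \<in> S \<Longrightarrow> f i x = a i + b i * x"
    using assms unfolding affine_on_def by metis
  show ?thesis
    unfolding affine_on_def
    by (intro exI[of _ "\<Sum>i\<in>I. c i * a i"] exI[of _ "\<Sum>i\<in>I. c i * b i"])
      (simp add: ab sum_distrib_right flip: sum.distrib, simp add: algebra_simps)
qed

text \<open>A combination of hat functions. The nodal data are arbitrary because the lemma provides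
  Lagrange interpolants, test functions isolating one node, and the function built from a solution
  of the linear system.\<close>

lemma V_h_interpolation:
  obtains g where "g \<in> V_h M" "\<And>i. i \<in> {first_node M..last_node M} \<Longrightarrow> g (node M i) = c i"
proof -
  define g where "g = (\<lambda>x. \<Sum>i\<in>{A + 1..B - 1}. c i * hat i x)"
  have "continuous_on UNIV g"
    unfolding g_def using hat_in_V_h by (intro continuous_intros) (auto simp: V_h_def)
  moreover have "g x = 0" if "x \<notin> {- s_minus M<..<s_plus M}" for x
    unfolding g_def using that hat_in_V_h by (intro sum.neutral) (auto simp: V_h_def)
  moreover have "affine_on (cell M j) g" if "j \<in> {A + 1..B}" for j
    unfolding g_def using that hat_in_V_h by (intro affine_on_sum) (auto simp: V_h_def)
  ultimately have "g \<in> V_h M"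
    by (auto simp: V_h_def)
  moreover have "g (node M i) = c i" if i: "i \<in> {first_node M..last_node M}" for i
  proof -
    have "g (p i) = (\<Sum>j\<in>{A + 1..B - 1}. if j = i then c j else 0)"
      unfolding g_def using i
      by (intro sum.cong) (auto simp: hat_breakpoint first_node_def last_node_def)
    then show ?thesis
      using i by (simp add: breakpoint_inner first_node_def last_node_def)
  qed
  ultimately show ?thesis
    by (rule that)
qed

lemma lagrange_interpolates:
  "lagrange M f \<in> V_h M"
  "i \<in> {first_node M..last_node M} \<Longrightarrow> lagrange M f (node M i) = f (node M i)"
proof -
  have "\<exists>!g. g \<in> V_h M \<and> (\<forall>i\<in>{first_node M..last_node M}. g (node M i) = f (node M i))"
  proof (rule V_h_interpolation[of "\<lambda>i. f (node M i)"])
    fix g assume g: "g \<in> V_h M" "\<And>i. i \<in> {first_node M..last_node M} \<Longrightarrow> g (node M i) = f (node M i)"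
    then show ?thesis
      by (intro ex1I[of _ g]) (auto intro!: V_h_eqI)
  qed
  from theI'[OF this] show "lagrange M f \<in> V_h M"
    "i \<in> {first_node M..last_node M} \<Longrightarrow> lagrange M f (node M i) = f (node M i)"
    unfolding lagrange_def by blast+
qed


section \<open>The parabolic step\<close>

lemma V_h_has_derivative:
  assumes "u \<in> V_h M" and i: "i \<in> {A + 1..B}" and x: "x \<in> {p (i - 1)<..<p i}"
  shows "(u has_field_derivative slope M u i) (at x)"
proof (rule has_field_derivative_transform_within_open)
  show "((\<lambda>x. u (p (i - 1)) + slope M u i * (x - p (i - 1))) has_field_derivative slope M u i) (at x)"
    by (auto intro!: derivative_eq_intros)
  show "open {p (i - 1)<..<p i}" "x \<in> {p (i - 1)<..<p i}"
    using x by auto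
  show "u (p (i - 1)) + slope M u i * (y - p (i - 1)) = u y" if "y \<in> {p (i - 1)<..<p i}" for y
    using that V_h_affine[OF assms(1) i, of y] by simp
qed

lemma V_h_deriv_outside:
  assumes u: "u \<in> V_h M" and x: "x < - s_minus M \<or> s_plus M < x"
  shows "deriv u x = 0"
proof -
  have "(u has_field_derivative 0) (at x)"
  proof (rule has_field_derivative_transform_within_open)
    show "((\<lambda>x. 0) has_field_derivative 0) (at x)" by simp
    show "open ({..<- s_minus M} \<union> {s_plus M<..})" "x \<in> {..<- s_minus M} \<union> {s_plus M<..}"
      using x by auto
    show "0 = u y" if "y \<in> {..<- s_minus M} \<union> {s_plus M<..}" for y
      using that V_h_outside[OF u, of y] by auto
  qed
  then show ?thesis
    by (rule DERIV_imp_deriv)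
qed

text \<open>On a cell \<open>deriv u\<close> is the constant slope, so the fundamental theorem of
  calculus integrates the derivative of the product exactly.\<close>

lemma l2_product_eq:
  assumes u: "u \<in> V_h M" and w: "w \<in> V_h M" and \<phi>: "\<phi> \<in> V_h M"
  shows "l2_product (deriv u) (deriv (\<lambda>x. w x * \<phi> x))
    = (\<Sum>i\<in>{A + 1..B}. slope M u i * (w (p i) * \<phi> (p i) - w (p (i - 1)) * \<phi> (p (i - 1))))"
proof -
  \<comment> \<open>\<open>L v i\<close> continues the affine formula of cell \<open>i\<close> to
    the whole line, so that the antiderivative is differentiable at the end points of the cell
    too.\<close>
  define L where "L v i x = v (p (i - 1)) + slope M v i * (x - p (i - 1))" for v i x
  define F' where "F' i x = slope M u i * (slope M w i * L \<phi> i x + L w i x * slope M \<phi> i)" for i x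
  have L: "L v i x = v x" if "v \<in> V_h M" "i \<in> {A + 1..B}" "x \<in> {p (i - 1)..p i}" for v i x
    unfolding L_def by (rule V_h_affine[symmetric]) (use that in auto)
  have cell_int: "has_bochner_integral lborel (\<lambda>x. F' i x * indicator {p (i - 1)..p i} x)
      (slope M u i * (w (p i) * \<phi> (p i) - w (p (i - 1)) * \<phi> (p (i - 1))))"
    if i: "i \<in> {A + 1..B}" for i
  proof -
    define F where "F x = slope M u i * (L w i x * L \<phi> i x)" for x
    have "(F has_field_derivative F' i x) (at x)" for x
      unfolding F_def F'_def L_def by (auto intro!: derivative_eq_intros)
    then have "has_bochner_integral lborel (\<lambda>x. F' i x * indicator {p (i - 1)..p i} x) (F (p i) - F (p (i - 1)))"
      using cell_pos[OF i]
      by (intro has_bochner_integral_FTC_Icc_real) (auto simp: F'_def L_def intro!: continuous_intros)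
    then show ?thesis
      using cell_pos[OF i] L[OF w i] L[OF \<phi> i] by (simp add: F_def algebra_simps)
  qed
  have "l2_product (deriv u) (deriv (\<lambda>x. w x * \<phi> x))
      = (\<integral>x. (\<Sum>i\<in>{A + 1..B}. F' i x * indicator {p (i - 1)..p i} x) \<partial>lborel)"
    unfolding l2_product_def
  \<comment> \<open>The breakpoints form a null set; there the closed cells overlap and
    \<open>deriv\<close> need not be a slope.\<close>
  proof (rule integral_discrete_difference[where X = "p ` {A..B}"])
    fix x assume x: "x \<notin> p ` {A..B}"
    show "deriv u x * deriv (\<lambda>x. w x * \<phi> x) x
        = (\<Sum>i\<in>{A + 1..B}. F' i x * indicator {p (i - 1)..p i} x)"
    proof (cases "x \<in> {- s_minus M..s_plus M}")
      case True
      then obtain i where i: "i \<in> {A + 1..B}" and "x \<in> {p (i - 1)..p i}"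
        by (rule cells_cover)
      moreover have "x \<noteq> p (i - 1)" "x \<noteq> p i"
        using x i by auto
      ultimately have xi: "x \<in> {p (i - 1)<..<p i}"
        by auto
      have "((\<lambda>x. w x * \<phi> x) has_field_derivative slope M w i * \<phi> x + w x * slope M \<phi> i) (at x)"
        by (rule derivative_eq_intros V_h_has_derivative[OF w i xi] V_h_has_derivative[OF \<phi> i xi] refl)+ simp
      then have "deriv u x * deriv (\<lambda>x. w x * \<phi> x) x = F' i x"
        using V_h_has_derivative[OF u i xi] xi
        by (simp add: DERIV_imp_deriv F'_def L[OF w i] L[OF \<phi> i])
      also have "\<dots> = (\<Sum>j\<in>{A + 1..B}. if j = i then F' j x else 0)"
        using i by simp
      also have "\<dots> = (\<Sum>j\<in>{A + 1..B}. F' j x * indicator {p (j - 1)..p j} x)"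
      proof (rule sum.cong[OF refl])
        fix j assume j: "j \<in> {A + 1..B}"
        have "x \<noteq> p j" "x \<noteq> p (j - 1)"
          using x j by auto
        then have "x \<in> {p (j - 1)..p j} \<longleftrightarrow> j = i"
          using cells_disjoint[OF i j xi] xi by auto
        then show "(if j = i then F' j x else 0) = F' j x * indicator {p (j - 1)..p j} x"
          by (simp add: indicator_def del: atLeastAtMost_iff)
      qed
      finally show ?thesis .
    next
      case False
      have "x \<notin> {p (i - 1)..p i}" if "i \<in> {A + 1..B}" for i
      proof -
        have "p A \<le> p (i - 1)" "p i \<le> p B"
          using that by (auto intro!: breakpoint_le simp del: breakpoint_left breakpoint_right)
        then show ?thesis
          using False by auto
      qed
      then have "(\<Sum>i\<in>{A + 1..B}. F' i x * indicator {p (i - 1)..p i} x) = 0"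
        by (intro sum.neutral) auto
      moreover have "deriv u x = 0"
        using False by (intro V_h_deriv_outside[OF u]) auto
      ultimately show ?thesis by simp
    qed
  qed (auto intro!: countable_finite)
  also have "\<dots> = (\<Sum>i\<in>{A + 1..B}. slope M u i * (w (p i) * \<phi> (p i) - w (p (i - 1)) * \<phi> (p (i - 1))))"
    by (rule has_bochner_integral_integral_eq, rule has_bochner_integral_sum, rule cell_int)
  finally show ?thesis .
qed

text \<open>Half the total length of the two cells meeting at the node, that is, the integral of its
  hat function.\<close>

definition mass :: "int \<Rightarrow> real" where
  "mass i = (if i = first_node M then 1 / 2 * (h_minus M + width M)
             else if i = last_node M then 1 / 2 * (h_plus M + width M) else width M)"

lemma mass_pos: "mass i > 0"
  using width_pos end_widths_pos by (simp add: mass_def)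

lemma lumped_product_eq:
  "lumped_product M f g = (\<Sum>i\<in>{first_node M..last_node M}. mass i * f (node M i) * g (node M i))"
proof -
  define a b where "a = first_node M" and "b = last_node M"
  have "a < b"
    using nodes_nonempty by (simp add: a_def b_def)
  then have "{a..b} = insert a (insert b {a + 1..b - 1})"
    by auto
  moreover have "(\<Sum>i\<in>{a + 1..b - 1}. mass i * f (node M i) * g (node M i))
      = width M * (\<Sum>i\<in>{a + 1..b - 1}. f (node M i) * g (node M i))"
    unfolding sum_distrib_left by (intro sum.cong) (auto simp: mass_def a_def b_def)
  ultimately show ?thesis
    using \<open>a < b\<close> by (simp add: lumped_product_def mass_def flip: a_def b_def)
qed

text \<open>Every term sees the test function only through its nodal values, so the variational
  equation says that the residuals \<open>E i\<close> are orthogonal to all nodal vectors. The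
  interpolants are likewise evaluated only at nodes and drop out.\<close>

lemma parabolic_solution_iff:
  assumes w: "w \<in> V_h M"
  shows "parabolic_solution m q \<tau> M w u \<longleftrightarrow> u \<in> V_h M \<and>
    (\<forall>i\<in>{first_node M..last_node M}.
      mass i * (1 - m * q * \<tau> * w (node M i) powr q) * u (node M i)
      + \<tau> * w (node M i) * (slope M u i - slope M u (i + 1))
      = mass i * (w (node M i) + m * (1 - q) * \<tau> * w (node M i) powr (q + 1)))"
    (is "_ \<longleftrightarrow> _ \<and> (\<forall>i\<in>?I. ?l i = ?r i)")
proof (cases "u \<in> V_h M")
  case False
  then show ?thesis
    by (simp add: parabolic_solution_def)
next
  case u: True
  have l2: "l2_product (deriv u) (deriv (\<lambda>x. w x * \<phi> x))
      = (\<Sum>i\<in>?I. (slope M u i - slope M u (i + 1)) * (w (node M i) * \<phi> (node M i)))"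
    if "\<phi> \<in> V_h M" for \<phi>
  proof -
    have "(\<Sum>i\<in>{A + 1..B}. slope M u i * (w (p i) * \<phi> (p i) - w (p (i - 1)) * \<phi> (p (i - 1))))
        = (\<Sum>i\<in>{A + 1..B - 1}. (slope M u i - slope M u (i + 1)) * (w (p i) * \<phi> (p i)))"
      using N_minus_ge N_plus_ge V_h_outside[OF w]
      by (intro sum_by_parts_zero_boundary[where p = "\<lambda>i. w (p i) * \<phi> (p i)"]) auto
    also have "\<dots> = (\<Sum>i\<in>?I. (slope M u i - slope M u (i + 1)) * (w (node M i) * \<phi> (node M i)))"
      by (intro sum.cong) (auto simp: breakpoint_inner first_node_def last_node_def)
    finally show ?thesis
      using l2_product_eq[OF u w that] by simp
  qed
  define E where "E i = ?l i - ?r i" for i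
  have eqn: "(lumped_product M u \<phi> + \<tau> * l2_product (deriv u) (deriv (\<lambda>x. w x * \<phi> x))
        = lumped_product M w \<phi>
          + m * q * \<tau> * lumped_product M (lagrange M (\<lambda>x. w x powr q * u x)) \<phi>
          + m * (1 - q) * \<tau> * lumped_product M (lagrange M (\<lambda>x. w x powr (q + 1))) \<phi>)
      \<longleftrightarrow> (\<Sum>i\<in>?I. E i * \<phi> (node M i)) = 0" if "\<phi> \<in> V_h M" for \<phi>
  proof -
    have "(\<Sum>i\<in>?I. E i * \<phi> (node M i))
      = (\<Sum>i\<in>?I. mass i * u (node M i) * \<phi> (node M i)
          + \<tau> * ((slope M u i - slope M u (i + 1)) * (w (node M i) * \<phi> (node M i)))
          - mass i * w (node M i) * \<phi> (node M i)
          - m * q * \<tau> * (mass i * lagrange M (\<lambda>x. w x powr q * u x) (node M i) * \<phi> (node M i))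
          - m * (1 - q) * \<tau> * (mass i * lagrange M (\<lambda>x. w x powr (q + 1)) (node M i) * \<phi> (node M i)))"
      by (intro sum.cong refl, simp only: lagrange_interpolates(2) E_def) (simp add: algebra_simps)
    then show ?thesis
      unfolding lumped_product_eq l2[OF that] sum.distrib sum_subtractf sum_distrib_left[symmetric]
      by (intro iffI; linarith)
  qed
  have "(\<forall>\<phi>\<in>V_h M. (\<Sum>i\<in>?I. E i * \<phi> (node M i)) = 0) \<longleftrightarrow> (\<forall>i\<in>?I. E i = 0)"
  proof safe
    fix j assume all: "\<forall>\<phi>\<in>V_h M. (\<Sum>i\<in>?I. E i * \<phi> (node M i)) = 0" and j: "j \<in> ?I"
    \<comment> \<open>Kronecker data isolate the residual at node \<open>j\<close>.\<close>
    obtain g where "g \<in> V_h M" and g: "\<And>i. i \<in> ?I \<Longrightarrow> g (node M i) = (if i = j then 1 else 0)"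
      using V_h_interpolation[of "\<lambda>i. if i = j then 1 else 0"] by blast
    then have "(\<Sum>i\<in>?I. E i * g (node M i)) = 0"
      using all by blast
    moreover have "(\<Sum>i\<in>?I. E i * g (node M i)) = (\<Sum>i\<in>?I. if i = j then E i else 0)"
      by (intro sum.cong) (auto simp: g)
    ultimately show "E j = 0"
      using j by simp
  qed simp
  then show ?thesis
    using u by (simp add: parabolic_solution_def eqn E_def)
qed

lemma V_h_slope_diff:
  assumes "u \<in> V_h M" "i \<in> {first_node M..last_node M}"
  shows "slope M u i - slope M u (i + 1)
    = (u (p i) - u (p (i - 1))) / (p i - p (i - 1)) - (u (p (i + 1)) - u (p i)) / (p (i + 1) - p i)"
  using assms by (simp add: V_h_slope first_node_def last_node_def)

definition coupling_left :: "real \<Rightarrow> (real \<Rightarrow> real) \<Rightarrow> int \<Rightarrow> real" where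
  "coupling_left \<tau> w i = \<tau> * w (node M i) / (p i - p (i - 1))"

definition coupling_right :: "real \<Rightarrow> (real \<Rightarrow> real) \<Rightarrow> int \<Rightarrow> real" where
  "coupling_right \<tau> w i = \<tau> * w (node M i) / (p (i + 1) - p i)"

text \<open>The lumped mass minus the implicit share q of the source term; the explicit share stays
  on the right as \<open>source\<close>.\<close>

definition reaction :: "real \<Rightarrow> real \<Rightarrow> real \<Rightarrow> (real \<Rightarrow> real) \<Rightarrow> int \<Rightarrow> real" where
  "reaction m q \<tau> w i = mass i * (1 - m * q * \<tau> * w (node M i) powr q)"

definition source :: "real \<Rightarrow> real \<Rightarrow> real \<Rightarrow> (real \<Rightarrow> real) \<Rightarrow> int \<Rightarrow> real" where
  "source m q \<tau> w i =
     mass i * (w (node M i) + m * (1 - q) * \<tau> * w (node M i) powr (q + 1))"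

lemma parabolic_solution_nodal_iff:
  assumes w: "w \<in> V_h M"
  shows "parabolic_solution m q \<tau> M w u \<longleftrightarrow> u \<in> V_h M \<and>
    (\<forall>i\<in>{first_node M..last_node M}.
      reaction m q \<tau> w i * u (p i) + coupling_left \<tau> w i * (u (p i) - u (p (i - 1)))
      - coupling_right \<tau> w i * (u (p (i + 1)) - u (p i)) = source m q \<tau> w i)"
proof -
  have "mass i * (1 - m * q * \<tau> * w (node M i) powr q) * u (node M i)
      + \<tau> * w (node M i) * (slope M u i - slope M u (i + 1))
      = reaction m q \<tau> w i * u (p i) + coupling_left \<tau> w i * (u (p i) - u (p (i - 1)))
        - coupling_right \<tau> w i * (u (p (i + 1)) - u (p i))"
    if "u \<in> V_h M" "i \<in> {first_node M..last_node M}" for i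
    unfolding V_h_slope_diff[OF that] coupling_left_def coupling_right_def reaction_def
      breakpoint_inner[OF that(2)]
    by (simp add: right_diff_distrib diff_divide_distrib)
  then show ?thesis
    unfolding parabolic_solution_iff[OF w] source_def
    by (intro conj_cong ball_cong refl) simp
qed

section \<open>Comparison and solvability for the nodal system\<close>

context
  fixes m q \<tau> C :: real and w :: "real \<Rightarrow> real"
  assumes m: "m > 0" and q: "0 < q" "q < 1" and \<tau>: "\<tau> > 0" and C: "C \<ge> 0"
    and w: "w \<in> V_h M"
    and w_range: "\<And>i. i \<in> {first_node M..last_node M} \<Longrightarrow> w (node M i) \<in> {0..C}"
    and small: "m * q * \<tau> * C powr q < 1"
begin

private abbreviation "l \<equiv> coupling_left \<tau> w"
private abbreviation "r \<equiv> coupling_right \<tau> w"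
private abbreviation "c \<equiv> reaction m q \<tau> w"
private abbreviation "f \<equiv> source m q \<tau> w"

private lemma reaction_ge: "mass i * (1 - m * q * \<tau> * C powr q) \<le> c i"
  if "i \<in> {first_node M..last_node M}"
proof -
  have "w (node M i) powr q \<le> C powr q"
    using w_range[OF that] q by (intro powr_mono2) auto
  then show ?thesis
    using m q \<tau> mass_pos[of i] unfolding reaction_def
    by (intro mult_left_mono diff_left_mono) auto
qed

private lemma coefficients:
  assumes i: "i \<in> {first_node M..last_node M}"
  shows "c i > 0 \<and> l i \<ge> 0 \<and> r i \<ge> 0"
proof -
  have "p (i - 1) < p i" "p i < p (i + 1)"
    using i by (auto intro!: breakpoint_less simp: first_node_def last_node_def)
  then have "l i \<ge> 0" "r i \<ge> 0"
    using w_range[OF i] \<tau> by (auto simp: coupling_left_def coupling_right_def)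
  moreover have "mass i * (1 - m * q * \<tau> * C powr q) > 0"
    using small mass_pos[of i] by simp
  ultimately show ?thesis
    using reaction_ge[OF i] by linarith
qed

private lemma nodal_min_principle:
  assumes "v A \<ge> 0" "v B \<ge> 0"
    and ineq: "\<And>i. i \<in> {first_node M..last_node M} \<Longrightarrow>
      c i * v i + l i * (v i - v (i - 1)) - r i * (v (i + 1) - v i) \<ge> 0"
    and j: "j \<in> {first_node M..last_node M}"
  shows "v j \<ge> 0"
proof (rule discrete_min_principle[where v = v and c = c and l = l and r = r, OF _ _ _ j])
  show "v (first_node M - 1) \<ge> 0" "v (last_node M + 1) \<ge> 0"
    using assms by (simp_all add: first_node_def last_node_def)
qed (use coefficients ineq in auto)

lemma parabolic_solution_range:
  assumes sol: "parabolic_solution m q \<tau> M w u"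
  shows "u x \<in> {0..C * (1 + m * (1 - q) * \<tau> * C powr q) / (1 - m * q * \<tau> * C powr q)}"
proof -
  \<comment> \<open>\<open>K\<close> solves the step for spatially constant data w = C, where all
    differences vanish.\<close>
  define K where "K = C * (1 + m * (1 - q) * \<tau> * C powr q) / (1 - m * q * \<tau> * C powr q)"
  have K: "K \<ge> 0"
    using m q \<tau> C small by (simp add: K_def)
  have u: "u \<in> V_h M"
    and eqs: "\<And>i. i \<in> {first_node M..last_node M} \<Longrightarrow>
      c i * u (p i) + l i * (u (p i) - u (p (i - 1))) - r i * (u (p (i + 1)) - u (p i)) = f i"
    using sol unfolding parabolic_solution_nodal_iff[OF w] by blast+
  have bd: "u (p A) = 0" "u (p B) = 0"
    using V_h_outside[OF u] by simp_all
  have nonneg: "u (p j) \<ge> 0" if "j \<in> {first_node M..last_node M}" for j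
  proof (rule nodal_min_principle[OF _ _ _ that])
    fix i assume i: "i \<in> {first_node M..last_node M}"
    have "f i \<ge> 0"
      using mass_pos[of i] w_range[OF i] m q \<tau> unfolding source_def
      by (intro mult_nonneg_nonneg add_nonneg_nonneg) auto
    then show "c i * u (p i) + l i * (u (p i) - u (p (i - 1))) - r i * (u (p (i + 1)) - u (p i)) \<ge> 0"
      using eqs[OF i] by simp
  qed (use bd in auto)
  \<comment> \<open>The constant \<open>K\<close> is a supersolution: replacing w by its bound C can
    only lower the reaction coefficient and raise the source. At the boundary the difference is
    \<open>K >= 0\<close>.\<close>
  have le_K: "K - u (p j) \<ge> 0" if "j \<in> {first_node M..last_node M}" for j
  proof (rule nodal_min_principle[OF _ _ _ that])
    fix i assume i: "i \<in> {first_node M..last_node M}"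
    let ?w = "w (node M i)"
    have "?w powr (q + 1) \<le> C powr (q + 1)"
      using w_range[OF i] q by (intro powr_mono2) auto
    then have "f i \<le> mass i * (C + m * (1 - q) * \<tau> * C powr (q + 1))"
      using w_range[OF i] m q \<tau> mass_pos[of i] unfolding source_def
      by (intro mult_left_mono add_mono) auto
    also have "C + m * (1 - q) * \<tau> * C powr (q + 1) = (1 - m * q * \<tau> * C powr q) * K"
    proof -
      have "(1 - m * q * \<tau> * C powr q) * K = C * (1 + m * (1 - q) * \<tau> * C powr q)"
        using small by (simp add: K_def)
      then show ?thesis
        using C by (simp add: powr_add distrib_left mult_ac)
    qed
    also have "mass i * ((1 - m * q * \<tau> * C powr q) * K) \<le> c i * K"
      using mult_right_mono[OF reaction_ge[OF i] K] by (simp add: mult.assoc)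
    finally have "f i \<le> c i * K" .
    then show "c i * (K - u (p i)) + l i * (K - u (p i) - (K - u (p (i - 1))))
        - r i * (K - u (p (i + 1)) - (K - u (p i))) \<ge> 0"
      using eqs[OF i] by (simp add: algebra_simps)
  qed (use bd K in auto)
  have "u x \<in> {0..K}"
  proof (rule V_h_bounds[OF u K])
    fix i assume i: "i \<in> {first_node M..last_node M}"
    show "u (node M i) \<in> {0..K}"
      using nonneg[OF i] le_K[OF i] unfolding breakpoint_inner[OF i] by simp
  qed
  then show ?thesis
    by (simp add: K_def)
qed

lemma parabolic_solution_ex1: "\<exists>!u. parabolic_solution m q \<tau> M w u"
proof -
  have "l i \<ge> 0 \<and> r i \<ge> 0 \<and> l i + r i < c i + l i + r i" if "i \<in> {first_node M..last_node M}" for i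
    using coefficients[OF that] by simp
  then obtain x where x0: "\<And>i. i \<notin> {first_node M..last_node M} \<Longrightarrow> x i = 0"
    and x: "\<And>i. i \<in> {first_node M..last_node M} \<Longrightarrow>
      (c i + l i + r i) * x i - l i * x (i - 1) - r i * x (i + 1) = f i"
    using tridiagonal_solvable[of "first_node M" "last_node M" l r "\<lambda>i. c i + l i + r i" f] by blast
  obtain u where u: "u \<in> V_h M" and ux: "\<And>i. i \<in> {first_node M..last_node M} \<Longrightarrow> u (node M i) = x i"
    using V_h_interpolation[of x] by blast
  \<comment> \<open>The zero extension of \<open>x\<close> agrees with the zero values of
    \<open>u\<close> at the ends of the support, so the first and last rows match as well.\<close>
  have up: "u (p i) = x i" if "i \<in> {A..B}" for i
  proof -
    have "i = A \<or> i = B \<or> i \<in> {first_node M..last_node M}"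
      using that by (auto simp: first_node_def last_node_def)
    then show ?thesis
      using x0[of A] x0[of B] V_h_outside[OF u]
      by (auto simp: ux breakpoint_inner first_node_def last_node_def)
  qed
  have "parabolic_solution m q \<tau> M w u"
    unfolding parabolic_solution_nodal_iff[OF w]
  proof (intro conjI ballI u)
    fix i assume i: "i \<in> {first_node M..last_node M}"
    then have "i \<in> {A..B}" "i - 1 \<in> {A..B}" "i + 1 \<in> {A..B}"
      by (auto simp: first_node_def last_node_def)
    then show "c i * u (p i) + l i * (u (p i) - u (p (i - 1))) - r i * (u (p (i + 1)) - u (p i)) = f i"
      using x[OF i] by (simp add: up algebra_simps)
  qed
  \<comment> \<open>The difference of two solutions satisfies the homogeneous equations; using the
    comparison in both orders gives uniqueness.\<close>
  moreover have le: "v (p j) \<le> u (p j)"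
    if v: "parabolic_solution m q \<tau> M w v" and u: "parabolic_solution m q \<tau> M w u"
      and j: "j \<in> {first_node M..last_node M}" for u v j
  proof -
    have uv: "u \<in> V_h M" "v \<in> V_h M"
      using u v by (auto simp: parabolic_solution_def)
    have "u (p j) - v (p j) \<ge> 0"
    proof (rule nodal_min_principle[OF _ _ _ j])
      show "u (p A) - v (p A) \<ge> 0" "u (p B) - v (p B) \<ge> 0"
        using uv by (simp_all add: V_h_outside)
      fix i assume "i \<in> {first_node M..last_node M}"
      then have "c i * u (p i) + l i * (u (p i) - u (p (i - 1))) - r i * (u (p (i + 1)) - u (p i))
          = c i * v (p i) + l i * (v (p i) - v (p (i - 1))) - r i * (v (p (i + 1)) - v (p i))"
        using u v by (simp add: parabolic_solution_nodal_iff[OF w])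
      then show "c i * (u (p i) - v (p i)) + l i * (u (p i) - v (p i) - (u (p (i - 1)) - v (p (i - 1))))
          - r i * (u (p (i + 1)) - v (p (i + 1)) - (u (p i) - v (p i))) \<ge> 0"
        by (simp add: algebra_simps)
    qed
    then show ?thesis by simp
  qed
  have "v = u" if v: "parabolic_solution m q \<tau> M w v" and u: "parabolic_solution m q \<tau> M w u" for u v
  proof (rule V_h_eqI)
    show "u \<in> V_h M" "v \<in> V_h M"
      using u v by (auto simp: parabolic_solution_def)
    fix i assume "i \<in> {first_node M..last_node M}"
    then show "v (node M i) = u (node M i)"
      using le[OF u v] le[OF v u] by (auto simp flip: breakpoint_inner intro: antisym)
  qed
  ultimately show ?thesis by blast
qed

end

end

section \<open>The essential supremum norm\<close>

text \<open>The set where |f| exceeds its essential supremum is open and null, hence empty. The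
  bound \<open>C\<close> keeps the essential supremum finite, so its conversion to a real number
  loses nothing.\<close>

lemma linf_norm_continuous:
  assumes "continuous_on UNIV f" and "\<And>x. \<bar>f x\<bar> \<le> (C :: real)"
  shows "\<bar>f x\<bar> \<le> linf_norm f" and "linf_norm f \<le> C"
proof -
  let ?e = "esssup lborel (\<lambda>x. ereal \<bar>f x\<bar>)"
  have [measurable]: "f \<in> borel_measurable borel"
    using assms(1) by (rule borel_measurable_continuous_onI)
  have ge: "ereal \<bar>f x\<bar> \<le> ?e" for x
  proof (rule ccontr)
    assume "\<not> ereal \<bar>f x\<bar> \<le> ?e"
    let ?S = "{y. ?e < ereal \<bar>f y\<bar>}"
    have "open ?S"
      using assms(1) by (intro open_Collect_less continuous_intros) auto
    moreover have "x \<in> ?S"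
      using \<open>\<not> ereal \<bar>f x\<bar> \<le> ?e\<close> by simp
    moreover have "?S \<in> null_sets lborel"
      using esssup_zero_measure[of lborel "\<lambda>x. ereal \<bar>f x\<bar>"] by (simp add: null_sets_def)
    then have "negligible ?S"
      unfolding negligible_iff_null_sets by (rule null_sets_completionI)
    ultimately show False
      using open_not_negligible[of ?S] by blast
  qed
  have le: "?e \<le> ereal C"
    using assms(2) by (intro esssup_I) auto
  from ge[of 0] le have eq: "?e = ereal (linf_norm f)"
    by (cases ?e) (auto simp: linf_norm_def)
  show "\<bar>f x\<bar> \<le> linf_norm f" "linf_norm f \<le> C"
    using ge[of x] le unfolding eq by simp_all
qed

section \<open>One step of the scheme\<close>

text \<open>The competitor y = x gives the lower bound, the sign of the quadratic penalty the upper
  one.\<close>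

lemma hopf_lax_range:
  assumes "m > 0" "\<tau> > 0" and u: "\<And>y. u y \<in> {0..C}"
  shows "hopf_lax m \<tau> u x \<in> {0..C}"
proof -
  have le: "u y - m * (x - y)\<^sup>2 / (4 * \<tau>) \<le> C" for y
  proof -
    have "m * (x - y)\<^sup>2 / (4 * \<tau>) \<ge> 0"
      using assms by simp
    moreover have "u y \<le> C"
      using u[of y] by simp
    ultimately show ?thesis by linarith
  qed
  then have "u x - m * (x - x)\<^sup>2 / (4 * \<tau>) \<le> hopf_lax m \<tau> u x"
    unfolding hopf_lax_def by (intro cSUP_upper bdd_aboveI2[of _ _ C]) auto
  moreover have "hopf_lax m \<tau> u x \<le> C"
    unfolding hopf_lax_def using le by (intro cSUP_least) auto
  ultimately show ?thesis
    using u[of x] by simp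
qed

context admissible_mesh
begin

text \<open>For nonnegative \<open>u\<close> the left end slope is nonnegative and the right one
  nonpositive, so both ends of the support move outwards or stay.\<close>

lemma admissible_next_mesh:
  assumes "m > 0" "\<tau> > 0" and u: "\<And>x. u x \<ge> 0"
  shows "admissible_mesh (next_mesh m \<tau> M u)"
proof -
  have "slope M u (A + 1) \<ge> 0" "slope M u B \<le> 0"
    using u N_minus_ge N_plus_ge end_widths_pos by (auto simp: slope_def)
  moreover have "\<tau> / m > 0"
    using assms(1,2) by simp
  ultimately have "\<tau> / m * slope M u (A + 1) \<ge> 0" "\<tau> / m * slope M u B \<le> 0"
    by (simp_all only: zero_le_mult_iff mult_le_0_iff less_imp_le simp_thms)
  then show ?thesis
    using width_pos s_minus_ge s_plus_ge
    by unfold_locales (simp_all add: next_mesh_def)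
qed

lemma scheme_step_range:
  assumes "m > 0" "0 < q" "q < 1" "\<tau> > 0" and u: "\<And>x. u x \<in> {0..C}"
    and small: "m * q * \<tau> * C powr q < 1"
  obtains M' u' where "scheme_step m q \<tau> (M, u) = Some (M', u')" "admissible_mesh M'" "u' \<in> V_h M'"
    "\<And>x. u' x \<in> {0..C * (1 + m * (1 - q) * \<tau> * C powr q) / (1 - m * q * \<tau> * C powr q)}"
proof -
  define M' where "M' = next_mesh m \<tau> M u"
  define w where "w = half_step m \<tau> M u"
  interpret new: admissible_mesh M'
    unfolding M'_def using assms by (intro admissible_next_mesh) auto
  have C: "C \<ge> 0"
    using u[of 0] by auto
  have w: "w \<in> V_h M'"
    unfolding w_def half_step_def M'_def[symmetric] by (rule new.lagrange_interpolates)
  have w_range: "w (node M' i) \<in> {0..C}" if "i \<in> {first_node M'..last_node M'}" for i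
    unfolding w_def half_step_def M'_def[symmetric] new.lagrange_interpolates(2)[OF that]
    by (rule hopf_lax_range[OF assms(1,4) u])
  have ex1: "\<exists>!u'. parabolic_solution m q \<tau> M' w u'"
    by (rule new.parabolic_solution_ex1[OF assms(1-4) C w w_range small])
  define u' where "u' = (THE u'. parabolic_solution m q \<tau> M' w u')"
  have sol: "parabolic_solution m q \<tau> M' w u'"
    unfolding u'_def by (rule theI'[OF ex1])
  show ?thesis
  proof (rule that)
    show "scheme_step m q \<tau> (M, u) = Some (M', u')"
      using ex1 by (simp add: scheme_step_def Let_def u'_def flip: M'_def w_def)
    show "admissible_mesh M'"
      by (rule new.admissible_mesh_axioms)
    show "u' \<in> V_h M'"
      using sol by (simp add: parabolic_solution_def)
    show "u' x \<in> {0..C * (1 + m * (1 - q) * \<tau> * C powr q) / (1 - m * q * \<tau> * C powr q)}" for x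
      by (rule new.parabolic_solution_range[OF assms(1-4) C w w_range small sol])
  qed
qed

end

section \<open>Growth of the bound over one time step\<close>

lemma one_plus_le_powr_minus:
  fixes y r :: real
  assumes "y < 1" "r \<ge> 0"
  shows "1 + r * y \<le> (1 - y) powr (- r)"
proof -
  have "ln (1 - y) \<le> - y"
    using ln_le_minus_one[of "1 - y"] assms by simp
  then have "r * y \<le> - r * ln (1 - y)"
    using mult_left_mono[of "ln (1 - y)" "- y" r] assms by simp
  then have "1 + r * y \<le> exp (- r * ln (1 - y))"
    using exp_ge_add_one_self[of "- r * ln (1 - y)"] by linarith
  then show ?thesis
    using assms by (simp add: powr_def)
qed

text \<open>Here \<open>C\<close> is the value at time t of the solution of C' = m C^(q+1) starting
  from \<open>U\<close>. One step of the scheme on constants stays below the exact flow over the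
  same time.\<close>

lemma growth_step:
  fixes m q t \<tau> U :: real
  defines "C \<equiv> U / (1 - m * q * t * U powr q) powr (1 / q)"
  assumes "m > 0" "0 < q" "q < 1" "t \<ge> 0" "\<tau> > 0" "U > 0"
    and D': "m * q * (t + \<tau>) * U powr q < 1"
  shows "m * q * \<tau> * C powr q < 1"
    and "C * (1 + m * (1 - q) * \<tau> * C powr q) / (1 - m * q * \<tau> * C powr q)
      \<le> U / (1 - m * q * (t + \<tau>) * U powr q) powr (1 / q)"
proof -
  define D where "D = 1 - m * q * t * U powr q"
  define y where "y = m * q * \<tau> * C powr q"
  have "m * q * \<tau> * U powr q > 0"
    using assms by simp
  then have "D > 0"
    using D' by (simp add: D_def algebra_simps)
  then have "C powr q = U powr q / D"
    using assms by (simp add: C_def powr_divide powr_powr flip: D_def)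
  then have "1 - y = (D - m * q * \<tau> * U powr q) / D"
    using \<open>D > 0\<close> by (simp add: y_def diff_divide_distrib)
  \<comment> \<open>\<open>1 - y\<close> is the quotient of the factors of the bound at times t +
    \<tau> and t. This yields the smallness condition and later makes the quotient of powers
    telescope.\<close>
  then have y: "1 - y = (1 - m * q * (t + \<tau>) * U powr q) / D"
    by (simp add: D_def algebra_simps)
  then have pos: "1 - y > 0"
    using D' \<open>D > 0\<close> by simp
  then show "m * q * \<tau> * C powr q < 1"
    by (simp add: y_def)
  have "C \<ge> 0"
    using assms by (simp add: C_def)
  have "C * (1 + m * (1 - q) * \<tau> * C powr q) / (1 - y) = C * (1 + (1 - q) / q * y) / (1 - y)"
    using assms by (simp add: y_def)
  also have "\<dots> \<le> C * (1 - y) powr (- ((1 - q) / q)) / (1 - y)"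
    using \<open>C \<ge> 0\<close> pos assms
    by (intro divide_right_mono mult_left_mono one_plus_le_powr_minus) auto
  also have "\<dots> = C * (1 - y) powr (- ((1 - q) / q) - 1)"
    using pos by (simp add: powr_diff)
  also have "- ((1 - q) / q) - 1 = - (1 / q)"
    using assms by (simp add: field_simps)
  also have "C * (1 - y) powr (- (1 / q)) = C / (1 - y) powr (1 / q)"
    by (simp add: powr_minus_divide)
  also have "\<dots> = U / (1 - m * q * (t + \<tau>) * U powr q) powr (1 / q)"
    unfolding y using \<open>D > 0\<close> D' by (simp add: C_def powr_divide flip: D_def)
  finally show "C * (1 + m * (1 - q) * \<tau> * C powr q) / (1 - m * q * \<tau> * C powr q)
      \<le> U / (1 - m * q * (t + \<tau>) * U powr q) powr (1 / q)"
    by (simp add: y_def)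
qed

text \<open>Otherwise the support has at most one point, whereas a nonempty open subset of the line
  is infinite.\<close>

lemma support_radius_pos:
  fixes f :: "real \<Rightarrow> real"
  assumes "continuous_on UNIV f" "\<exists>x. f x \<noteq> 0" "closure {x. f x \<noteq> 0} = {- s..s}"
  shows "s > 0"
proof (rule ccontr)
  assume "\<not> s > 0"
  then have "finite {- s..s}"
    by (cases "s = 0") auto
  then have "finite {x. f x \<noteq> 0}"
    using assms(3) closure_subset finite_subset by metis
  moreover have "open {x. f x \<noteq> 0}"
    using assms(1) by (intro open_Collect_neq) (auto intro: continuous_intros)
  ultimately show False
    using assms(2) finite_imp_not_open by blast
qed

theorem theorem2p4:
  fixes m q s0 :: real and N :: nat and u0 uh0 :: "real \<Rightarrow> real" and \<tau> :: "nat \<Rightarrow> real"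
  assumes "m > 0" and "0 < q" and "q < 1"
    and "continuous_on UNIV u0" and "\<And>x. u0 x \<ge> 0" and "\<exists>x. u0 x \<noteq> 0"
    and "closure {x. u0 x \<noteq> 0} = {- s0..s0}"
    and "N \<ge> 2"
    and "\<And>n. \<tau> n > 0"
    and uh0: "uh0 = lagrange (initial_mesh s0 N) u0"
    and "\<exists>x. uh0 x \<noteq> 0"
    and step: "\<And>n M u. numerical_solution m q s0 N u0 \<tau> n = Some (M, u) \<Longrightarrow>
           \<tau> n / width M * linf_norm (discrete_deriv M u) \<le> m / 2 \<and>
           m * q * \<tau> n * linf_norm (half_step m (\<tau> n) M u) powr q < 1"
  shows "\<forall>n. time_level \<tau> n < 1 / (m * q * linf_norm uh0 powr q) \<longrightarrow>
           (\<exists>M u. numerical_solution m q s0 N u0 \<tau> n = Some (M, u) \<and>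
              linf_norm u \<le>
                linf_norm uh0 / (1 - m * q * time_level \<tau> n * linf_norm uh0 powr q) powr (1 / q))"
proof -
  define M0 where "M0 = initial_mesh s0 N"
  define U where "U = linf_norm uh0"
  define bound where "bound t = U / (1 - m * q * t * U powr q) powr (1 / q)" for t
  have "s0 > 0"
    using assms(4,6,7) by (rule support_radius_pos)
  then interpret initial: admissible_mesh M0
    using \<open>N \<ge> 2\<close> by unfold_locales (auto simp: M0_def initial_mesh_def field_simps)
  have uh0_V: "uh0 \<in> V_h M0"
    unfolding uh0 M0_def[symmetric] by (rule initial.lagrange_interpolates)
  \<comment> \<open>A provisional bound from the finitely many nodal values: it makes
    \<open>uh0\<close> bounded, so that \<open>linf_norm uh0\<close> controls it pointwise and can
    take over as \<open>U\<close>.\<close>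
  define K where "K = Max ((\<lambda>i. u0 (node M0 i)) ` {first_node M0..last_node M0})"
  have nodes: "uh0 (node M0 i) \<in> {0..K}" if "i \<in> {first_node M0..last_node M0}" for i
    using that assms(5)
    by (simp add: uh0 initial.lagrange_interpolates(2) K_def flip: M0_def)
  have "K \<ge> 0"
    using nodes[of 0] initial.nodes_nonempty by simp
  have range: "uh0 x \<in> {0..K}" for x
    by (rule initial.V_h_bounds[OF uh0_V \<open>K \<ge> 0\<close> nodes])
  have cont: "continuous_on UNIV u" if "u \<in> V_h M" for u M
    using that by (simp add: V_h_def)
  have le_U: "\<bar>uh0 x\<bar> \<le> U" for x
    unfolding U_def using range by (intro linf_norm_continuous(1)[of uh0 K] cont[OF uh0_V]) auto
  obtain x where "uh0 x \<noteq> 0"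
    using assms(11) by blast
  then have "U > 0"
    using le_U[of x] by linarith
  \<comment> \<open>The time restriction is t_n < T_1 with the denominator cleared. The range is
    pointwise because Hopf-Lax and the nodal comparison use values; the norm returns only at the
    end.\<close>
  have invariant: "\<exists>M u. numerical_solution m q s0 N u0 \<tau> n = Some (M, u) \<and> admissible_mesh M \<and>
      u \<in> V_h M \<and> (\<forall>x. u x \<in> {0..bound (time_level \<tau> n)})"
    if "m * q * time_level \<tau> n * U powr q < 1" for n
    using that
  proof (induction n)
    case 0
    have "uh0 x \<in> {0..bound 0}" for x
      using range[of x] le_U[of x] by (simp add: bound_def)
    then show ?case
      using uh0_V initial.admissible_mesh_axioms
      by (auto simp: time_level_def uh0 M0_def)
  next
    case (Suc n)
    have t: "time_level \<tau> n \<ge> 0"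
      unfolding time_level_def using assms(9) by (intro sum_nonneg) (simp add: less_imp_le)
    have Suc_t: "time_level \<tau> (Suc n) = time_level \<tau> n + \<tau> n"
      by (simp add: time_level_def)
    \<comment> \<open>Time levels increase, so the restriction at level n + 1 implies the one at
      level n and the induction hypothesis applies.\<close>
    have "m * q * time_level \<tau> n * U powr q \<le> m * q * time_level \<tau> (Suc n) * U powr q"
      unfolding Suc_t using assms(1,2) assms(9)[of n]
      by (intro mult_right_mono mult_left_mono) auto
    then obtain M u where sol: "numerical_solution m q s0 N u0 \<tau> n = Some (M, u)"
      and "admissible_mesh M" and u: "\<And>x. u x \<in> {0..bound (time_level \<tau> n)}"
      using Suc by force
    then interpret admissible_mesh M by simp
    note growth = growth_step[OF assms(1-3) t assms(9) \<open>U > 0\<close> Suc.prems[unfolded Suc_t],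
        folded bound_def]
    obtain M' u' where "scheme_step m q (\<tau> n) (M, u) = Some (M', u')" "admissible_mesh M'" "u' \<in> V_h M'"
      and u': "\<And>x. u' x \<in> {0..bound (time_level \<tau> n) * (1 + m * (1 - q) * \<tau> n * bound (time_level \<tau> n) powr q)
        / (1 - m * q * \<tau> n * bound (time_level \<tau> n) powr q)}"
      by (rule scheme_step_range[where u = u, OF assms(1-3) assms(9) u growth(1)], rule that)
    moreover have "u' x \<in> {0..bound (time_level \<tau> (Suc n))}" for x
      using u'[of x] growth(2) unfolding Suc_t by auto
    ultimately show ?case
      using sol by auto
  qed
  show ?thesis
  proof (intro allI impI)
    fix n assume "time_level \<tau> n < 1 / (m * q * linf_norm uh0 powr q)"
    then have "m * q * time_level \<tau> n * U powr q < 1"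
      using \<open>U > 0\<close> assms(1,2) by (simp add: U_def field_simps)
    then obtain M u where sol: "numerical_solution m q s0 N u0 \<tau> n = Some (M, u)"
      and "u \<in> V_h M" and u: "\<And>x. u x \<in> {0..bound (time_level \<tau> n)}"
      using invariant by blast
    have "linf_norm u \<le> bound (time_level \<tau> n)"
      using u by (intro linf_norm_continuous(2) cont[OF \<open>u \<in> V_h M\<close>]) auto
    then show "\<exists>M u. numerical_solution m q s0 N u0 \<tau> n = Some (M, u) \<and> linf_norm u \<le>
        linf_norm uh0 / (1 - m * q * time_level \<tau> n * linf_norm uh0 powr q) powr (1 / q)"
      using sol by (auto simp: bound_def U_def)
  qed
qed

end
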